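(* Let $\Omega\subset\mathbb{R}^n$ be closed and convex and let $f:\mathbb{R}^n\to\mathbb{R}$ admit continuous derivatives for all $x$ in an open set that contains $\Omega$. Let $\{x^k\}$ be generated by Algorithm A (described in the context) with data $f_{\mathrm{target}}$, $\Delta$, $\gamma$, $\{\eta_k\}$, $x^0$. Let $\eta=\sum_{k=0}^\infty \eta_k$ and assume that the level set $\{x\in\Omega : f(x)\le f(x^0)+\eta\}$ is bounded. Assume moreover that there exists an infinite set of indices $K_1\subset\mathbb{N}$ such that $$\lim_{k\in K_1}\left\| v^k-\frac{\nabla f(x^k)}{\|\nabla f(x^k)\|}\right\|=0 .$$ Then, given $\varepsilon>0$, either there exists an iterate $x^k$ such that $f(x^k)\le f_{\mathrm{target}}+\varepsilon$, or there exists a limit point $x_*$ of $\{x^k\}$ such that $\langle\nabla f(x_* ),d\rangle\ge 0$ for all $d\in\mathbb{R}^n$ such that $x_*+d\in\Omega$.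
   Context: Here $\|\cdot\|$ is an arbitrary norm on $\mathbb{R}^n$, $\langle\cdot,\cdot\rangle$ is the Euclidean inner product, and the problem considered is to minimize $f(x)$ subject to $x\in\Omega$. For an infinite set $K\subset\mathbb{N}$, $\lim_{k\in K}$ denotes the limit as $k\to\infty$ with $k\in K$. The displayed condition on $v^k$ implicitly requires $\nabla f(x^k)\ne 0$ for the indices $k\in K_1$ involved. Algorithm A. Given are $f_{\mathrm{target}}\in\mathbb{R}$, $\Delta>0$, $\gamma\in(0,1)$, a sequence $\{\eta_k\}_{k\ge 0}$ of positive numbers with $\sum_{k=0}^\infty\eta_k<\infty$, and an initial guess $x^0\in\Omega$. Set $k\leftarrow 0$. Step 1. If $f(x^k)\le f_{\mathrm{target}}$, terminate. Step 2. Choose (arbitrarily) $v^k\in\mathbb{R}^n$ with $\|v^k\|=1$. Step 3. Compute $d^k$ as a solution of: minimize $\langle v^k,d\rangle$ subject to $\|d\|\le\Delta$ and $x^k+d\in\Omega$. Step 4. Set $\alpha\leftarrow 1$. Step 5. Set $x^{\mathrm{trial}}\leftarrow x^k+\alpha d^k$. Step 6. Test the descent condition $f(x^{\mathrm{trial}})\le f(x^k)+\eta_k-\gamma\alpha^2[f(x^k)-f_{\mathrm{target}}]$. Step 7. If the descent condition holds, define $\alpha_k=\alpha$, compute (any) $x^{k+1}\in\Omega$ such that $f(x^{k+1})\le f(x^{\mathrm{trial}})$, set $k\leftarrow k+1$ and go to Step 1. Otherwise, update $\alpha\leftarrow\alpha/2$ and go to Step 5. *)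

theory Defs
  imports "HOL-Analysis.Analysis"
begin

definition is_norm :: "(real^'n \<Rightarrow> real) \<Rightarrow> bool" where
  "is_norm N \<longleftrightarrow>
     (\<forall>x. 0 \<le> N x) \<and>
     (\<forall>x. N x = 0 \<longleftrightarrow> x = 0) \<and>
     (\<forall>a x. N (a *\<^sub>R x) = \<bar>a\<bar> * N x) \<and>
     (\<forall>x y. N (x + y) \<le> N x + N y)"

definition descent_cond ::
  "(real^'n \<Rightarrow> real) \<Rightarrow> real \<Rightarrow> real \<Rightarrow> real \<Rightarrow> real^'n \<Rightarrow> real^'n \<Rightarrow> real \<Rightarrow> bool" where
  "descent_cond f ftarget \<gamma> \<eta>k xk dk \<alpha> \<longleftrightarrow>
     f (xk + \<alpha> *\<^sub>R dk) \<le> f xk + \<eta>k - \<gamma> * \<alpha>\<^sup>2 * (f xk - ftarget)"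

text \<open>One pass through the steps following the stopping test, from the iterate \<open>xk\<close> to \<open>xk'\<close>.
  The step length accepted by the halving loop is \<open>(1/2)^j\<close> with \<open>j\<close> the first number of
  halvings for which the descent condition holds.\<close>

definition iteration_A ::
  "(real^'n \<Rightarrow> real) \<Rightarrow> (real^'n \<Rightarrow> real) \<Rightarrow> (real^'n) set \<Rightarrow> real \<Rightarrow> real \<Rightarrow> real \<Rightarrow> real
   \<Rightarrow> real^'n \<Rightarrow> real^'n \<Rightarrow> real^'n \<Rightarrow> real \<Rightarrow> real^'n \<Rightarrow> bool" where
  "iteration_A N f \<Omega> ftarget \<Delta> \<gamma> \<eta>k xk vk dk \<alpha>k xk' \<longleftrightarrow>
     N vk = 1 \<and>
     is_arg_min (\<lambda>d. vk \<bullet> d) (\<lambda>d. N d \<le> \<Delta> \<and> xk + d \<in> \<Omega>) dk \<and>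
     (\<exists>j::nat. \<alpha>k = (1/2)^j \<and>
        descent_cond f ftarget \<gamma> \<eta>k xk dk ((1/2)^j) \<and>
        (\<forall>i<j. \<not> descent_cond f ftarget \<gamma> \<eta>k xk dk ((1/2)^i))) \<and>
     xk' \<in> \<Omega> \<and> f xk' \<le> f (xk + \<alpha>k *\<^sub>R dk)"

text \<open>A run of the algorithm. \<open>T\<close> is the number of completed iterations, \<open>T = \<infinity>\<close> if the stopping
  test \<open>f (x k) \<le> ftarget\<close> never succeeds. The iterates are the \<open>x k\<close> with \<open>k \<le> T\<close>, and
  \<open>v k\<close>, \<open>d k\<close>, \<open>\<alpha> k\<close> are computed for \<open>k < T\<close>; the values at other indices are irrelevant.\<close>

definition run_A ::
  "(real^'n \<Rightarrow> real) \<Rightarrow> (real^'n \<Rightarrow> real) \<Rightarrow> (real^'n) set \<Rightarrow> real \<Rightarrow> real \<Rightarrow> real \<Rightarrow> (nat \<Rightarrow> real)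
   \<Rightarrow> enat \<Rightarrow> (nat \<Rightarrow> real^'n) \<Rightarrow> (nat \<Rightarrow> real^'n) \<Rightarrow> (nat \<Rightarrow> real^'n) \<Rightarrow> (nat \<Rightarrow> real) \<Rightarrow> bool" where
  "run_A N f \<Omega> ftarget \<Delta> \<gamma> \<eta> T x v d \<alpha> \<longleftrightarrow>
     x 0 \<in> \<Omega> \<and>
     (\<forall>k. enat k < T \<longrightarrow>
        \<not> f (x k) \<le> ftarget \<and>
        iteration_A N f \<Omega> ftarget \<Delta> \<gamma> (\<eta> k) (x k) (v k) (d k) (\<alpha> k) (x (Suc k))) \<and>
     (\<forall>k. T = enat k \<longrightarrow> f (x k) \<le> ftarget)"

end

(*
  If every iterate stays above ftarget + eps, the accepted steps satisfy
  gamma * eps * (sum of alpha_k^2) <= f x_0 + sum eta_k - ftarget, hence alpha_k -> 0, and the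
  iterates stay in the bounded level set. Along a subsequence of K_1 with x_k -> xs and d_k -> ds
  the doubled step 2 alpha_k was rejected; dividing by it and using the mean value theorem gives
  <grad f(xs), ds> >= 0. As v_k approaches the normalised gradient, the optimality of d_k passes
  to the limit, so <grad f(xs), h> >= <grad f(xs), ds> for feasible h with N h < Delta, and
  convexity of Omega extends the sign to all feasible h.
*)

theory Submission
  imports Defs
begin

section \<open>Continuity and comparison estimates for an arbitrary norm\<close>

lemma is_norm_continuous_on:
  fixes N :: "real^'n \<Rightarrow> real"
  assumes "is_norm N"
  shows "continuous_on A N"
proof -
  \<comment> \<open>Continuity comes from convexity: a real-valued convex function on an open set in
    finite dimension is continuous.\<close>
  have "convex_on UNIV N"
  proof (rule convex_onI)
    fix t :: real and x y :: "real^'n"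
    assume t: "0 < t" "t < 1"
    have "N ((1 - t) *\<^sub>R x + t *\<^sub>R y) \<le> N ((1 - t) *\<^sub>R x) + N (t *\<^sub>R y)"
      using assms unfolding is_norm_def by blast
    also have "\<dots> = \<bar>1 - t\<bar> * N x + \<bar>t\<bar> * N y"
      using assms by (simp add: is_norm_def)
    finally show "N ((1 - t) *\<^sub>R x + t *\<^sub>R y) \<le> (1 - t) * N x + t * N y"
      using t by simp
  qed simp
  then have "continuous_on UNIV N"
    by (rule convex_on_continuous[OF open_UNIV])
  then show ?thesis
    by (rule continuous_on_subset) simp
qed

lemma is_norm_tendsto:
  fixes N :: "real^'n \<Rightarrow> real"
  assumes "is_norm N" "(g \<longlongrightarrow> l) F"
  shows "((\<lambda>k. N (g k)) \<longlongrightarrow> N l) F"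
  using continuous_on_tendsto_compose[OF is_norm_continuous_on[OF assms(1), of UNIV] assms(2)] by simp

text \<open>By compactness \<open>N\<close> attains its minimum on the Euclidean unit sphere, and
  definiteness makes it positive; its reciprocal serves as \<open>c\<close>, and homogeneity covers
  all other vectors.\<close>

lemma is_norm_ge_norm:
  fixes N :: "real^'n \<Rightarrow> real"
  assumes "is_norm N"
  obtains c where "c > 0" "\<And>x. norm x \<le> c * N x"
proof -
  have "sphere (0::real^'n) 1 \<noteq> {}"
    using norm_axis_1[where ?'a = 'n] by (metis dist_0_norm empty_iff mem_sphere)
  then obtain u where u: "u \<in> sphere 0 1" and min: "\<And>x. x \<in> sphere 0 1 \<Longrightarrow> N u \<le> N x"
    using continuous_attains_inf[OF compact_sphere _ is_norm_continuous_on[OF assms]] by metis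
  have "N u \<noteq> 0" "0 \<le> N u"
    using u assms by (auto simp: is_norm_def)
  then have pos: "N u > 0" by simp
  have "norm x \<le> (1 / N u) * N x" for x
  proof (cases "x = 0")
    case True
    then show ?thesis using assms by (simp add: is_norm_def)
  next
    case False
    then have "N u \<le> N ((1 / norm x) *\<^sub>R x)"
      by (intro min) simp
    also have "\<dots> = (1 / norm x) * N x"
      using assms by (simp add: is_norm_def)
    finally show ?thesis
      using pos False by (simp add: field_simps)
  qed
  then show thesis
    using that[of "1 / N u"] pos by simp
qed

lemma is_norm_tendsto_0D:
  fixes N :: "real^'n \<Rightarrow> real"
  assumes "is_norm N" "((\<lambda>k. N (g k)) \<longlongrightarrow> 0) F"
  shows "(g \<longlongrightarrow> 0) F"
proof -
  obtain c where "c > 0" and c: "\<And>x. norm x \<le> c * N x"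
    using is_norm_ge_norm[OF assms(1)] by metis
  show ?thesis
    by (rule Lim_null_comparison[of _ "\<lambda>k. c * N (g k)"])
      (auto simp: c intro!: tendsto_mult_right_zero assms(2))
qed

section \<open>Mean value estimates and single iterations\<close>

lemma GDERIV_mvt_segment:
  fixes f :: "'a::euclidean_space \<Rightarrow> real"
  assumes "0 < t" and "\<And>s. 0 \<le> s \<Longrightarrow> s \<le> t \<Longrightarrow> GDERIV f (x + s *\<^sub>R d) :> g (x + s *\<^sub>R d)"
  obtains s where "0 < s" "s < t" "f (x + t *\<^sub>R d) - f x = t * (g (x + s *\<^sub>R d) \<bullet> d)"
proof -
  have der: "((\<lambda>s. f (x + s *\<^sub>R d)) has_real_derivative g (x + s *\<^sub>R d) \<bullet> d) (at s)"
    if "0 \<le> s" "s \<le> t" for s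
  proof -
    have "(f has_derivative (\<lambda>h. h \<bullet> g (x + s *\<^sub>R d))) (at (x + s *\<^sub>R d))"
      using assms(2)[OF that] by (simp add: gderiv_def inner_commute)
    moreover have "((\<lambda>s. x + s *\<^sub>R d) has_derivative (\<lambda>h. h *\<^sub>R d)) (at s)"
      by (auto intro!: derivative_eq_intros)
    ultimately have "((\<lambda>s. f (x + s *\<^sub>R d)) has_derivative (\<lambda>h. (h *\<^sub>R d) \<bullet> g (x + s *\<^sub>R d))) (at s)"
      using diff_chain_at by (fastforce simp: o_def)
    then show ?thesis
      by (simp add: has_field_derivative_def inner_commute mult_commute_abs)
  qed
  obtain s where "0 < s" "s < t"
    "f (x + t *\<^sub>R d) - f (x + 0 *\<^sub>R d) = (t - 0) * (g (x + s *\<^sub>R d) \<bullet> d)"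
    using MVT2[OF assms(1) der] by blast
  then show thesis using that by simp
qed

lemma iteration_A_decrease:
  assumes "iteration_A N f \<Omega> ftarget \<Delta> \<gamma> \<eta>k xk vk dk \<alpha>k xk'"
  shows "f xk' \<le> f xk + \<eta>k - \<gamma> * \<alpha>k\<^sup>2 * (f xk - ftarget)"
  using assms by (force simp: iteration_A_def descent_cond_def)

text \<open>An accepted step below 1 has been halved at least once, so the trial just before it was
  twice as long and failed the test.\<close>

lemma iteration_A_rejected:
  assumes "iteration_A N f \<Omega> ftarget \<Delta> \<gamma> \<eta>k xk vk dk \<alpha>k xk'" and "\<alpha>k < 1"
  shows "0 < 2 * \<alpha>k" "2 * \<alpha>k \<le> 1" "\<not> descent_cond f ftarget \<gamma> \<eta>k xk dk (2 * \<alpha>k)"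
proof -
  obtain j :: nat where j: "\<alpha>k = (1/2)^j"
    and rej: "\<And>i. i < j \<Longrightarrow> \<not> descent_cond f ftarget \<gamma> \<eta>k xk dk ((1/2)^i)"
    using assms(1) by (auto simp: iteration_A_def)
  obtain i where i: "j = Suc i"
    using j assms(2) by (cases j) auto
  have "2 * \<alpha>k = (1/2)^i"
    using j i by simp
  then show "0 < 2 * \<alpha>k" "2 * \<alpha>k \<le> 1" "\<not> descent_cond f ftarget \<gamma> \<eta>k xk dk (2 * \<alpha>k)"
    using rej[of i] i by (auto intro: power_le_one)
qed

text \<open>Rejection bounds the increment of \<open>f\<close> below by
  \<open>-\<gamma> t^2 (f x - ftarget)\<close>, since \<open>\<eta>k\<close> only helps. Dividing by
  \<open>t\<close> leaves one factor \<open>t\<close>, which makes the bound vanish for small steps.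
  Convexity keeps the segment in \<open>\<Omega>\<close>, where the gradient is available.\<close>

lemma rejected_step_mean_value:
  fixes f :: "real^'n \<Rightarrow> real"
  assumes "\<not> descent_cond f ftarget \<gamma> \<eta>k x d t" "0 < t" "t \<le> 1" "\<eta>k \<ge> 0"
    and "convex \<Omega>" "x \<in> \<Omega>" "x + d \<in> \<Omega>"
    and "\<And>y. y \<in> \<Omega> \<Longrightarrow> GDERIV f y :> g y"
  obtains s where "0 < s" "s < t" "x + s *\<^sub>R d \<in> \<Omega>"
    "- (\<gamma> * t * (f x - ftarget)) \<le> g (x + s *\<^sub>R d) \<bullet> d"
proof -
  have seg: "x + s *\<^sub>R d \<in> \<Omega>" if "0 \<le> s" "s \<le> t" for s
  proof -
    have "(1 - s) *\<^sub>R x + s *\<^sub>R (x + d) \<in> \<Omega>"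
      using assms that by (intro convexD) auto
    then show ?thesis by (simp add: algebra_simps)
  qed
  obtain s where s: "0 < s" "s < t" "f (x + t *\<^sub>R d) - f x = t * (g (x + s *\<^sub>R d) \<bullet> d)"
    using GDERIV_mvt_segment[OF assms(2), of f x d g] assms(8) seg by blast
  have "t * (- (\<gamma> * t * (f x - ftarget))) \<le> t * (g (x + s *\<^sub>R d) \<bullet> d)"
    using assms(1,4) s(3) by (simp add: descent_cond_def power2_eq_square algebra_simps)
  then have "- (\<gamma> * t * (f x - ftarget)) \<le> g (x + s *\<^sub>R d) \<bullet> d"
    using assms(2) mult_le_cancel_left_pos by blast
  then show thesis
    using that[of s] s seg[of s] by simp
qed

section \<open>Summability of the squared step lengths\<close>

lemma run_A_sum_bound:
  assumes "run_A N f \<Omega> ftarget \<Delta> \<gamma> \<eta> \<infinity> x v d \<alpha>" and "0 < \<gamma>"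
    and "\<And>k. f (x k) \<ge> ftarget + \<epsilon>"
  shows "f (x k) + \<gamma> * \<epsilon> * (\<Sum>i<k. (\<alpha> i)\<^sup>2) \<le> f (x 0) + (\<Sum>i<k. \<eta> i)"
proof (induction k)
  case 0
  then show ?case by simp
next
  case (Suc k)
  have "f (x (Suc k)) \<le> f (x k) + \<eta> k - \<gamma> * (\<alpha> k)\<^sup>2 * (f (x k) - ftarget)"
    using assms(1) by (intro iteration_A_decrease) (auto simp: run_A_def)
  \<comment> \<open>The gap to the target is at least \<epsilon>, so each iteration gains a fixed
    multiple of the squared step, up to the error \<open>\<eta> k\<close>.\<close>
  moreover have "\<gamma> * (\<alpha> k)\<^sup>2 * \<epsilon> \<le> \<gamma> * (\<alpha> k)\<^sup>2 * (f (x k) - ftarget)"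
    using assms(2) assms(3)[of k] by (intro mult_left_mono) auto
  ultimately show ?case
    using Suc by (simp add: algebra_simps)
qed

text \<open>The values of \<open>f\<close> stay above the target and the errors are summable, so the
  total gain is finite. Hence the squared steps form a convergent series and tend to 0.\<close>

lemma run_A_step_tendsto_0:
  assumes "run_A N f \<Omega> ftarget \<Delta> \<gamma> \<eta> \<infinity> x v d \<alpha>" and "0 < \<gamma>" "\<epsilon> > 0"
    and "\<And>k. f (x k) \<ge> ftarget + \<epsilon>" and "\<And>k. \<eta> k > 0" "summable \<eta>"
  shows "\<alpha> \<longlonglongrightarrow> 0"
proof -
  have "(\<Sum>i<k. (\<alpha> i)\<^sup>2) \<le> (f (x 0) + suminf \<eta> - ftarget) / (\<gamma> * \<epsilon>)" for k
  proof -
    have "(\<Sum>i<k. \<eta> i) \<le> suminf \<eta>"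
      using assms(5,6) by (intro sum_le_suminf) (auto intro: less_imp_le)
    then have "\<gamma> * \<epsilon> * (\<Sum>i<k. (\<alpha> i)\<^sup>2) \<le> f (x 0) + suminf \<eta> - ftarget"
      using run_A_sum_bound[OF assms(1,2,4), of k] assms(3) assms(4)[of k] by simp
    then show ?thesis
      using assms(2,3) by (simp add: field_simps)
  qed
  then have "summable (\<lambda>k. (\<alpha> k)\<^sup>2)"
    by (intro summableI_nonneg_bounded) auto
  then have "(\<lambda>k. (\<alpha> k)\<^sup>2) \<longlonglongrightarrow> 0"
    by (rule summable_LIMSEQ_zero)
  then show ?thesis
    using tendsto_real_sqrt[of "\<lambda>k. (\<alpha> k)\<^sup>2" 0] by (simp add: tendsto_rabs_zero_iff)
qed

text \<open>Shrinking \<open>h\<close> by \<open>\<Delta> / (\<Delta> + N h)\<close> puts it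
  strictly inside the ball; convexity keeps it feasible, and positive scaling preserves the
  sign.\<close>

lemma variational_inequality_of_local:
  fixes g y :: "real^'n"
  assumes "is_norm N" "convex \<Omega>" "y \<in> \<Omega>" "\<Delta> > 0"
    and "\<And>h. y + h \<in> \<Omega> \<Longrightarrow> N h < \<Delta> \<Longrightarrow> g \<bullet> h \<ge> 0"
    and "y + h \<in> \<Omega>"
  shows "g \<bullet> h \<ge> 0"
proof -
  define s where "s = \<Delta> / (\<Delta> + N h)"
  have "N h \<ge> 0" using assms(1) by (simp add: is_norm_def)
  then have s: "0 < s" "s \<le> 1" using assms(4) by (auto simp: s_def)
  have "(1 - s) *\<^sub>R y + s *\<^sub>R (y + h) \<in> \<Omega>"
    using assms s by (intro convexD) auto
  then have "y + s *\<^sub>R h \<in> \<Omega>" by (simp add: algebra_simps)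
  moreover have "N (s *\<^sub>R h) = s * N h"
    using assms(1) s by (simp add: is_norm_def)
  moreover have "s * N h < \<Delta>"
    using assms(4) \<open>N h \<ge> 0\<close> by (simp add: s_def field_simps)
  ultimately have "g \<bullet> (s *\<^sub>R h) \<ge> 0" by (intro assms(5)) auto
  then show ?thesis using s by (simp add: zero_le_mult_iff)
qed

theorem theorem2p1:
  fixes N :: "real^'n \<Rightarrow> real"
    and \<Omega> U :: "(real^'n) set"
    and f :: "real^'n \<Rightarrow> real"
    and gradf :: "real^'n \<Rightarrow> real^'n"
    and ftarget \<Delta> \<gamma> \<epsilon> :: real
    and \<eta> \<alpha> :: "nat \<Rightarrow> real"
    and T :: enat
    and x v d :: "nat \<Rightarrow> real^'n"
    and K1 :: "nat set"
  assumes "is_norm N"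
    and "closed \<Omega>" and "convex \<Omega>"
    and "open U" and "\<Omega> \<subseteq> U"
    and "\<And>y. y \<in> U \<Longrightarrow> GDERIV f y :> gradf y"
    and "continuous_on U gradf"
    and "\<Delta> > 0" and "0 < \<gamma>" and "\<gamma> < 1"
    and "\<And>k. \<eta> k > 0" and "summable \<eta>"
    and "run_A N f \<Omega> ftarget \<Delta> \<gamma> \<eta> T x v d \<alpha>"
    and "bounded {y \<in> \<Omega>. f y \<le> f (x 0) + (\<Sum>k. \<eta> k)}"
    and "infinite K1"
    and "\<And>k. k \<in> K1 \<Longrightarrow> enat k < T"
    and "\<And>k. k \<in> K1 \<Longrightarrow> gradf (x k) \<noteq> 0"
    and "((\<lambda>k. N (v k - (1 / N (gradf (x k))) *\<^sub>R gradf (x k))) \<longlongrightarrow> 0)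
           (inf sequentially (principal K1))"
    and "\<epsilon> > 0"
  shows "(\<exists>k. enat k \<le> T \<and> f (x k) \<le> ftarget + \<epsilon>) \<or>
         (\<exists>xstar (r::nat \<Rightarrow> nat). strict_mono r \<and> (x \<circ> r) \<longlonglongrightarrow> xstar \<and>
            (\<forall>h. xstar + h \<in> \<Omega> \<longrightarrow> gradf xstar \<bullet> h \<ge> 0))"
proof (rule ccontr)
  assume neg: "\<not> ?thesis"
  \<comment> \<open>Infinitely many indices of \<open>K1\<close> lie below \<open>T\<close>, so the
    run never terminates.\<close>
  have "T = \<infinity>"
  proof (cases T)
    case (enat m)
    then have "K1 \<subseteq> {..<m}" using assms(16) by auto
    then show ?thesis using assms(15) finite_subset by blast
  qed simp
  note norm = assms(1)
  have run: "run_A N f \<Omega> ftarget \<Delta> \<gamma> \<eta> \<infinity> x v d \<alpha>"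
    using assms(13) \<open>T = \<infinity>\<close> by simp
  have iter: "iteration_A N f \<Omega> ftarget \<Delta> \<gamma> (\<eta> k) (x k) (v k) (d k) (\<alpha> k) (x (Suc k))" for k
    using run by (simp add: run_A_def)
  have above: "f (x k) \<ge> ftarget + \<epsilon>" for k
    using neg \<open>T = \<infinity>\<close> by (auto simp: not_le intro: less_imp_le)
  have x\<Omega>: "x k \<in> \<Omega>" for k
    using run iter by (cases k) (auto simp: run_A_def iteration_A_def)
  have below: "f (x k) \<le> f (x 0) + suminf \<eta>" for k
  proof -
    have "(\<Sum>i<k. \<eta> i) \<le> suminf \<eta>"
      using assms(11,12) by (intro sum_le_suminf) (auto intro: less_imp_le)
    moreover have "\<gamma> * \<epsilon> * (\<Sum>i<k. (\<alpha> i)\<^sup>2) \<ge> 0"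
      using assms(9,19) by (simp add: sum_nonneg)
    ultimately show ?thesis
      using run_A_sum_bound[OF run assms(9) above, of k] by simp
  qed
  have \<alpha>0: "\<alpha> \<longlonglongrightarrow> 0"
    by (rule run_A_step_tendsto_0[OF run assms(9,19) above assms(11,12)])
  have argmin: "is_arg_min (\<lambda>d. v k \<bullet> d) (\<lambda>d. N d \<le> \<Delta> \<and> x k + d \<in> \<Omega>) (d k)" for k
    using iter[of k] by (simp add: iteration_A_def)
  then have d\<Omega>: "x k + d k \<in> \<Omega>" and dN: "N (d k) \<le> \<Delta>" for k
    by (auto simp: is_arg_min_def)
  obtain c where "c > 0" and c: "\<And>y. norm y \<le> c * N y"
    using is_norm_ge_norm[OF norm] by metis
  have "norm (d k) \<le> c * \<Delta>" for k
    using c[of "d k"] mult_left_mono[OF dN[of k], of c] \<open>c > 0\<close> by linarith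
  then have "bounded (range d)"
    by (auto simp: bounded_iff)
  moreover have "bounded (range x)"
    using assms(14) by (rule bounded_subset) (use x\<Omega> below in auto)
  \<comment> \<open>Pairing iterates with directions lets one extraction make both converge.\<close>
  ultimately have bdd: "bounded (range x \<times> range d)"
    by (simp add: bounded_Times)
  \<comment> \<open>Enumerating \<open>K1\<close> before extracting keeps the final subsequence
    \<open>r\<close> inside \<open>K1\<close>.\<close>
  define e where "e = enumerate K1"
  have e: "strict_mono e" "\<And>k. e k \<in> K1"
    using assms(15) by (auto simp: e_def strict_mono_enumerate enumerate_in_set)
  have "bounded (range (\<lambda>k. (x (e k), d (e k))))"
    by (rule bounded_subset[OF bdd]) auto
  from bounded_imp_convergent_subsequence[OF this]
  obtain p q where pq: "strict_mono q" "((\<lambda>k. (x (e k), d (e k))) \<circ> q) \<longlonglongrightarrow> p"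
    by blast
  define r where "r = e \<circ> q"
  define xs where "xs = fst p"
  define ds where "ds = snd p"
  have r: "strict_mono r" "\<And>k. r k \<in> K1"
    using e pq(1) by (auto simp: r_def strict_mono_o)
  have limx: "(\<lambda>k. x (r k)) \<longlonglongrightarrow> xs"
    using tendsto_fst[OF pq(2)] by (simp add: o_def r_def xs_def)
  have limd: "(\<lambda>k. d (r k)) \<longlonglongrightarrow> ds"
    using tendsto_snd[OF pq(2)] by (simp add: o_def r_def ds_def)
  have xs\<Omega>: "xs \<in> \<Omega>"
    by (rule closed_sequentially[OF assms(2) _ limx]) (rule x\<Omega>)
  have contg: "(\<lambda>k. gradf (u k)) \<longlonglongrightarrow> gradf xs" if "u \<longlonglongrightarrow> xs" for u
  proof -
    have "isCont gradf xs"
      using assms(4,5,7) xs\<Omega> continuous_on_eq_continuous_at by blast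
    then show ?thesis using that by (rule isCont_tendsto_compose)
  qed
  have nonstat: "\<not> (\<forall>h. xs + h \<in> \<Omega> \<longrightarrow> gradf xs \<bullet> h \<ge> 0)"
    using neg r(1) limx by (auto simp: o_def)
  \<comment> \<open>A zero gradient would satisfy the variational inequality trivially. Nonvanishing
    makes the normalised gradient continuous at \<open>xs\<close>.\<close>
  then have "gradf xs \<noteq> 0" by auto
  then have N0: "N (gradf xs) \<noteq> 0" "N (gradf xs) > 0"
    using norm by (auto simp: is_norm_def order_less_le)

  \<comment> \<open>This is the last rejected trial step whenever \<open>t k < 2\<close>, that is,
    whenever the accepted step is below 1.\<close>
  define t where "t k = 2 * \<alpha> (r k)" for k
  have limt: "t \<longlonglongrightarrow> 0"
    using tendsto_mult_right_zero[OF LIMSEQ_subseq_LIMSEQ[OF \<alpha>0 r(1)], of 2]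
    by (simp add: t_def[abs_def] o_def)
  have ev1: "\<forall>\<^sub>F k in sequentially. t k < 2"
    using limt by (rule order_tendstoD) simp
  \<comment> \<open>The implication makes the choice of \<open>s\<close> total; its values at the
    finitely many \<open>k\<close> with \<open>t k \<ge> 2\<close> are arbitrary.\<close>
  have "\<exists>s. t k < 2 \<longrightarrow> 0 < s \<and> s < t k \<and>
      - (\<gamma> * t k * (f (x (r k)) - ftarget)) \<le> gradf (x (r k) + s *\<^sub>R d (r k)) \<bullet> d (r k)" for k
  proof (cases "t k < 2")
    case True
    then have "\<alpha> (r k) < 1" by (simp add: t_def)
    note rej = iteration_A_rejected[OF iter this, folded t_def]
    obtain s where "0 < s" "s < t k"
      "- (\<gamma> * t k * (f (x (r k)) - ftarget)) \<le> gradf (x (r k) + s *\<^sub>R d (r k)) \<bullet> d (r k)"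
      by (rule rejected_step_mean_value[OF rej(3,1,2) less_imp_le[OF assms(11)] assms(3) x\<Omega> d\<Omega>])
        (use assms(5,6) in auto)
    then show ?thesis by blast
  qed simp
  then obtain s where s: "\<And>k. t k < 2 \<Longrightarrow> 0 < s k \<and> s k < t k \<and>
      - (\<gamma> * t k * (f (x (r k)) - ftarget)) \<le> gradf (x (r k) + s k *\<^sub>R d (r k)) \<bullet> d (r k)"
    by metis
  have "s \<longlonglongrightarrow> 0"
    by (rule tendsto_sandwich[OF _ _ tendsto_const limt])
      (use ev1 in eventually_elim; use s in \<open>auto intro: less_imp_le\<close>)+
  then have limu: "(\<lambda>k. x (r k) + s k *\<^sub>R d (r k)) \<longlonglongrightarrow> xs"
    using tendsto_add[OF limx tendsto_scaleR[OF _ limd], of s 0] by simp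
  have lim1: "(\<lambda>k. gradf (x (r k) + s k *\<^sub>R d (r k)) \<bullet> d (r k)) \<longlonglongrightarrow> gradf xs \<bullet> ds"
    by (intro tendsto_inner contg limu limd)
  \<comment> \<open>\<open>M\<close> bounds every gap \<open>f (x k) - ftarget\<close>, so the lower
    bound on the slopes tends to 0 with \<open>t\<close>.\<close>
  define M where "M = f (x 0) + suminf \<eta> - ftarget"
  have "\<forall>\<^sub>F k in sequentially.
      - (\<gamma> * t k * M) \<le> gradf (x (r k) + s k *\<^sub>R d (r k)) \<bullet> d (r k)"
    using ev1
  proof eventually_elim
    case (elim k)
    then have "\<gamma> * t k * (f (x (r k)) - ftarget) \<le> \<gamma> * t k * M"
      using s[OF elim] assms(9) below[of "r k"] by (intro mult_left_mono) (auto simp: M_def)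
    then show ?case using s[OF elim] by linarith
  qed
  moreover have "(\<lambda>k. - (\<gamma> * t k * M)) \<longlonglongrightarrow> - (\<gamma> * 0 * M)"
    by (intro tendsto_intros limt)
  ultimately have ds_ge: "gradf xs \<bullet> ds \<ge> 0"
    using tendsto_le[OF sequentially_bot lim1] by fastforce

  define vs where "vs = (1 / N (gradf xs)) *\<^sub>R gradf xs"
  \<comment> \<open>Since \<open>r\<close> tends to infinity within \<open>K1\<close>, the
    hypothesis on \<open>v\<close> can be pulled back along \<open>r\<close>.\<close>
  have "filterlim r (inf sequentially (principal K1)) sequentially"
    using r filterlim_subseq[OF r(1)] by (simp add: filterlim_inf filterlim_principal)
  from filterlim_compose[OF assms(18) this]
  have "(\<lambda>k. v (r k) - (1 / N (gradf (x (r k)))) *\<^sub>R gradf (x (r k))) \<longlonglongrightarrow> 0"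
    by (rule is_norm_tendsto_0D[OF norm])
  moreover have "(\<lambda>k. (1 / N (gradf (x (r k)))) *\<^sub>R gradf (x (r k))) \<longlonglongrightarrow> vs"
    unfolding vs_def by (intro tendsto_intros is_norm_tendsto[OF norm] contg limx N0)
  ultimately have limv: "(\<lambda>k. v (r k)) \<longlonglongrightarrow> vs"
    using tendsto_add by fastforce

  have "gradf xs \<bullet> h \<ge> 0" if h: "xs + h \<in> \<Omega>" "N h < \<Delta>" for h
  proof -
    \<comment> \<open>The competitor is recentred so that it leads from \<open>x (r k)\<close>
      exactly to the feasible point \<open>xs + h\<close>. The strict bound
      \<open>N h < \<Delta>\<close> makes it eventually admissible in the subproblem solved by
      \<open>d (r k)\<close>.\<close>
    have limh: "(\<lambda>k. xs + h - x (r k)) \<longlonglongrightarrow> h"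
      using tendsto_diff[OF tendsto_const limx, of "xs + h"] by simp
    have "\<forall>\<^sub>F k in sequentially. N (xs + h - x (r k)) < \<Delta>"
      using is_norm_tendsto[OF norm limh] h(2) by (rule order_tendstoD)
    then have "\<forall>\<^sub>F k in sequentially. v (r k) \<bullet> d (r k) \<le> v (r k) \<bullet> (xs + h - x (r k))"
    proof eventually_elim
      case (elim k)
      then show ?case
        using argmin[of "r k"] h(1) by (auto simp: is_arg_min_def not_less)
    qed
    then have "vs \<bullet> ds \<le> vs \<bullet> h"
      by (intro tendsto_le[OF sequentially_bot tendsto_inner[OF limv limh] tendsto_inner[OF limv limd]])
    \<comment> \<open>\<open>vs\<close> is a positive multiple of the gradient, so the inequality
      survives rescaling.\<close>
    then have "gradf xs \<bullet> ds \<le> gradf xs \<bullet> h"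
      using N0 by (simp add: vs_def divide_le_cancel)
    then show ?thesis using ds_ge by simp
  qed
  then show False
    using nonstat variational_inequality_of_local[OF norm assms(3) xs\<Omega> assms(8)] by blast
qed

end
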